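(* Let $p$ be an odd prime and let $x$ be any $p$-adic integer. (i) If $x\equiv2k\pmod p$ with $k\in\{0,\ldots,(p-1)/2\}$, then $$\sum_{r=0}^{p-1}(-1)^r\binom xr^2\equiv(-1)^k\binom xk\pmod{p^2}.$$ (ii) If $x\equiv k\pmod p$ with $k\in\{0,\ldots,p-1\}$, then $$\sum_{r=0}^{p-1}\binom xr^2\equiv\binom{2x}k\pmod{p^2}.$$
   Context: For a $p$-adic integer $x$ and an integer $r\ge0$, $\binom xr=x(x-1)\cdots(x-r+1)/r!$, which is a $p$-adic integer. Congruences are in the ring of $p$-adic integers. *)

theory Defs
  imports Complex_Main "HOL-Algebra.Ring" "HOL-Algebra.Divisibility" "HOL-Number_Theory.Cong"
begin

hide_const (open) Divisibility.prime

text \<open>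
  The ring of \<open>p\<close>-adic integers as the inverse limit of the rings of integers modulo \<open>p ^ n\<close>:
  the \<open>n\<close>-th component of an element is its residue modulo \<open>p ^ n\<close>, represented in
  \<open>{0..<p ^ n}\<close> (so the component at \<open>0\<close> is always \<open>0\<close>).
\<close>

definition padic_int :: "nat \<Rightarrow> (nat \<Rightarrow> int) ring" where
  "padic_int p = \<lparr>
     carrier = {x. \<forall>n. x n \<in> {0..<int p ^ n} \<and> x (Suc n) mod int p ^ n = x n},
     monoid.mult = (\<lambda>x y n. (x n * y n) mod int p ^ n),
     one = (\<lambda>n. 1 mod int p ^ n),
     zero = (\<lambda>n. 0),
     add = (\<lambda>x y n. (x n + y n) mod int p ^ n)\<rparr>"

definition ring_cong :: "('a, 'b) ring_scheme \<Rightarrow> nat \<Rightarrow> 'a \<Rightarrow> 'a \<Rightarrow> bool" where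
  "ring_cong R m a b \<longleftrightarrow> ([m] \<cdot>\<^bsub>R\<^esub> \<one>\<^bsub>R\<^esub>) divides\<^bsub>R\<^esub> (a \<ominus>\<^bsub>R\<^esub> b)"

text \<open>
  The binomial coefficient \<open>x (x - 1) \<dots> (x - r + 1) / r!\<close>, as the quotient in \<open>R\<close>.
  It is meaningful where that quotient exists in \<open>R\<close> and is unique; the lemma
  \<open>padic_int_binom_ex1\<close> below shows this for the \<open>p\<close>-adic integers.
\<close>

definition ring_binom :: "('a, 'b) ring_scheme \<Rightarrow> 'a \<Rightarrow> nat \<Rightarrow> 'a" where
  "ring_binom R x r = (THE b. b \<in> carrier R \<and>
     [(fact r :: nat)] \<cdot>\<^bsub>R\<^esub> b =
       (\<Otimes>\<^bsub>R\<^esub>i\<in>{..<r}. x \<ominus>\<^bsub>R\<^esub> ([i] \<cdot>\<^bsub>R\<^esub> \<one>\<^bsub>R\<^esub>)))"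

lemma padic_int_zero: "\<zero>\<^bsub>padic_int p\<^esub> = (\<lambda>n. 0)"
  and padic_int_one: "\<one>\<^bsub>padic_int p\<^esub> = (\<lambda>n. 1 mod int p ^ n)"
  and padic_int_add: "x \<oplus>\<^bsub>padic_int p\<^esub> y = (\<lambda>n. (x n + y n) mod int p ^ n)"
  and padic_int_mult: "x \<otimes>\<^bsub>padic_int p\<^esub> y = (\<lambda>n. (x n * y n) mod int p ^ n)"
  by (simp_all add: padic_int_def)

lemma padic_int_mod_mod: "k mod int p ^ Suc n mod int p ^ n = k mod int p ^ n"
  by (rule mod_mod_cancel) (simp add: le_imp_power_dvd)

lemma padic_int_memI:
  assumes "p > 0" "\<And>n. [f (Suc n) = f n] (mod int p ^ n)"
  shows "(\<lambda>n. f n mod int p ^ n) \<in> carrier (padic_int p)"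
proof -
  have "f (Suc n) mod int p ^ Suc n mod int p ^ n = f n mod int p ^ n" for n
    using assms(2)[of n] by (simp only: padic_int_mod_mod cong_def)
  then show ?thesis
    using assms(1) by (simp add: padic_int_def)
qed

lemma padic_int_memD:
  assumes "x \<in> carrier (padic_int p)"
  shows "[x (Suc n) = x n] (mod int p ^ n)" "x n mod int p ^ n = x n"
  using assms by (auto simp: padic_int_def cong_def)

lemma padic_int_cong_le:
  assumes "x \<in> carrier (padic_int p)" "m \<le> n"
  shows "[x n = x m] (mod int p ^ m)"
  using assms(2)
proof (induction n rule: dec_induct)
  case (step n)
  have "[x (Suc n) = x n] (mod int p ^ m)"
    using padic_int_memD(1)[OF assms(1)] step.hyps by (meson cong_dvd_modulus le_imp_power_dvd)
  with step.IH show ?case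
    by (blast intro: cong_trans)
qed simp

lemma cring_padic_int:
  assumes "p > 0"
  shows "cring (padic_int p)"
proof (rule cringI)
  show "abelian_group (padic_int p)"
  proof (rule abelian_groupI)
    fix x y assume xy: "x \<in> carrier (padic_int p)" "y \<in> carrier (padic_int p)"
    show "x \<oplus>\<^bsub>padic_int p\<^esub> y \<in> carrier (padic_int p)"
      using padic_int_memI[OF assms, of "\<lambda>n. x n + y n"]
        cong_add[OF padic_int_memD(1)[OF xy(1)] padic_int_memD(1)[OF xy(2)]]
      by (simp add: padic_int_def)
  next
    show "\<zero>\<^bsub>padic_int p\<^esub> \<in> carrier (padic_int p)"
      using assms by (simp add: padic_int_def)
  next
    fix x assume x: "x \<in> carrier (padic_int p)"
    show "\<zero>\<^bsub>padic_int p\<^esub> \<oplus>\<^bsub>padic_int p\<^esub> x = x"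
      using padic_int_memD(2)[OF x] by (simp add: padic_int_def)
    have "(\<lambda>n. (- x n) mod int p ^ n) \<in> carrier (padic_int p)"
      by (rule padic_int_memI[OF assms])
        (use padic_int_memD(1)[OF x] in \<open>simp add: cong_minus_minus_iff\<close>)
    then show "\<exists>y\<in>carrier (padic_int p). y \<oplus>\<^bsub>padic_int p\<^esub> x = \<zero>\<^bsub>padic_int p\<^esub>"
      by (rule bexI[rotated]) (simp add: padic_int_def mod_simps)
  qed (auto simp: padic_int_def mod_simps add_ac)
next
  show "comm_monoid (padic_int p)"
  proof (rule comm_monoidI)
    fix x y assume xy: "x \<in> carrier (padic_int p)" "y \<in> carrier (padic_int p)"
    show "x \<otimes>\<^bsub>padic_int p\<^esub> y \<in> carrier (padic_int p)"
      using padic_int_memI[OF assms, of "\<lambda>n. x n * y n"]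
        cong_mult[OF padic_int_memD(1)[OF xy(1)] padic_int_memD(1)[OF xy(2)]]
      by (simp add: padic_int_def)
  next
    show "\<one>\<^bsub>padic_int p\<^esub> \<in> carrier (padic_int p)"
      using padic_int_memI[OF assms, of "\<lambda>n. 1"] by (simp add: padic_int_def)
  next
    fix x assume x: "x \<in> carrier (padic_int p)"
    show "\<one>\<^bsub>padic_int p\<^esub> \<otimes>\<^bsub>padic_int p\<^esub> x = x"
      using padic_int_memD(2)[OF x] by (simp add: padic_int_def mod_simps)
  qed (auto simp: padic_int_def mod_simps mult_ac)
qed (simp add: padic_int_add padic_int_mult mod_simps distrib_right)

lemma padic_int_add_pow:
  assumes "p > 0" "x \<in> carrier (padic_int p)"
  shows "[(m::nat)] \<cdot>\<^bsub>padic_int p\<^esub> x = (\<lambda>n. (int m * x n) mod int p ^ n)"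
proof -
  interpret cring "padic_int p" by (rule cring_padic_int[OF assms(1)])
  show ?thesis
  proof (induction m)
    case 0
    show ?case by (simp add: padic_int_zero)
  next
    case (Suc m)
    have "[Suc m] \<cdot>\<^bsub>padic_int p\<^esub> x = [m] \<cdot>\<^bsub>padic_int p\<^esub> x \<oplus>\<^bsub>padic_int p\<^esub> x"
      by simp
    also have "\<dots> = (\<lambda>n. (int (Suc m) * x n) mod int p ^ n)"
      unfolding Suc.IH padic_int_add by (simp add: mod_simps algebra_simps)
    finally show ?case .
  qed
qed

lemma padic_int_of_nat:
  assumes "p > 0"
  shows "[(m::nat)] \<cdot>\<^bsub>padic_int p\<^esub> \<one>\<^bsub>padic_int p\<^esub> = (\<lambda>n. int m mod int p ^ n)"
proof -
  interpret cring "padic_int p" by (rule cring_padic_int[OF assms])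
  show ?thesis
    using padic_int_add_pow[OF assms one_closed, of m] by (simp add: padic_int_one mod_simps)
qed

lemma padic_int_diff:
  assumes "p > 0" "x \<in> carrier (padic_int p)" "y \<in> carrier (padic_int p)"
  shows "x \<ominus>\<^bsub>padic_int p\<^esub> y = (\<lambda>n. (x n - y n) mod int p ^ n)"
proof -
  interpret cring "padic_int p" by (rule cring_padic_int[OF assms(1)])
  have z: "(\<lambda>n. (x n - y n) mod int p ^ n) \<in> carrier (padic_int p)"
    by (intro padic_int_memI cong_diff padic_int_memD assms)
  have "(\<lambda>n. (x n - y n) mod int p ^ n) \<oplus>\<^bsub>padic_int p\<^esub> y = x"
    using padic_int_memD(2)[OF assms(2)] by (simp add: padic_int_add mod_simps)
  then show ?thesis
    using z assms(2,3) by (metis a_minus_def add.inv_solve_right)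
qed

lemma padic_int_falling:
  assumes "p > 0" "x \<in> carrier (padic_int p)"
  shows "(\<Otimes>\<^bsub>padic_int p\<^esub>i\<in>{..<r}. x \<ominus>\<^bsub>padic_int p\<^esub> ([i] \<cdot>\<^bsub>padic_int p\<^esub> \<one>\<^bsub>padic_int p\<^esub>))
           = (\<lambda>n. (\<Prod>i<r. x n - int i) mod int p ^ n)"
proof -
  interpret cring "padic_int p" by (rule cring_padic_int[OF assms(1)])
  show ?thesis
  proof (induction r)
    case 0
    show ?case by (simp add: padic_int_one)
  next
    case (Suc r)
    have "(\<Otimes>\<^bsub>padic_int p\<^esub>i\<in>{..<Suc r}. x \<ominus>\<^bsub>padic_int p\<^esub> ([i] \<cdot>\<^bsub>padic_int p\<^esub> \<one>\<^bsub>padic_int p\<^esub>))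
        = (x \<ominus>\<^bsub>padic_int p\<^esub> ([r] \<cdot>\<^bsub>padic_int p\<^esub> \<one>\<^bsub>padic_int p\<^esub>)) \<otimes>\<^bsub>padic_int p\<^esub>
          (\<Otimes>\<^bsub>padic_int p\<^esub>i\<in>{..<r}. x \<ominus>\<^bsub>padic_int p\<^esub> ([i] \<cdot>\<^bsub>padic_int p\<^esub> \<one>\<^bsub>padic_int p\<^esub>))"
      unfolding lessThan_Suc by (rule finprod_insert) (use assms in auto)
    also have "x \<ominus>\<^bsub>padic_int p\<^esub> ([r] \<cdot>\<^bsub>padic_int p\<^esub> \<one>\<^bsub>padic_int p\<^esub>)
        = (\<lambda>n. (x n - int r) mod int p ^ n)"
      using padic_int_diff[OF assms add.nat_pow_closed[OF one_closed], of r]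
      by (simp add: padic_int_of_nat[OF assms(1)] mod_simps)
    finally show ?case
      unfolding Suc.IH by (simp add: padic_int_mult mod_simps mult.commute)
  qed
qed

lemma prime_power_mult_dvd_cancel:
  fixes p m :: nat and d :: int
  assumes "prime p" "m > 0" "int p ^ (n + multiplicity p m) dvd int m * d"
  shows "int p ^ n dvd d"
proof -
  from assms obtain m' where m': "m = p ^ multiplicity p m * m'" "\<not> p dvd m'"
    by (metis gr_implies_not0 multiplicity_decompose' not_prime_unit)
  define v where "v = multiplicity p m"
  have eq: "int m = int p ^ v * int m'"
    using m'(1) unfolding v_def[symmetric] by (metis of_nat_mult of_nat_power)
  have "int p ^ v * int p ^ n dvd int p ^ v * (int m' * d)"
    using assms(3) unfolding v_def[symmetric] eq by (simp add: power_add mult_ac)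
  then have "int p ^ n dvd int m' * d"
    using assms(1) by (simp add: prime_gt_0_nat)
  moreover have "coprime (int p ^ n) (int m')"
    using assms(1) m'(2) by (simp add: prime_imp_coprime)
  ultimately show ?thesis
    by (simp add: coprime_dvd_mult_right_iff)
qed

lemma padic_int_binom_ex1:
  assumes "prime p" "x \<in> carrier (padic_int p)"
  shows "\<exists>!b. b \<in> carrier (padic_int p) \<and>
           [(fact r :: nat)] \<cdot>\<^bsub>padic_int p\<^esub> b =
             (\<Otimes>\<^bsub>padic_int p\<^esub>i\<in>{..<r}. x \<ominus>\<^bsub>padic_int p\<^esub> ([i] \<cdot>\<^bsub>padic_int p\<^esub> \<one>\<^bsub>padic_int p\<^esub>))"
proof -
  have p: "p > 0" using assms(1) by (simp add: prime_gt_0_nat)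
  define v where "v = multiplicity p (fact r :: nat)"
  define q where "q = (\<lambda>a. (\<Prod>i<r. a - int i) div fact r)"
  have fact_q: "int (fact r) * q a = (\<Prod>i<r. a - int i)" for a :: int
  proof -
    have "fact r dvd (\<Prod>i=0..<r. a - int i)"
      using fact_dvd_pochhammer[of r "a - int r + 1"] by (simp only: falling_fact_pochhammer' of_nat_id)
    then show ?thesis
      by (simp add: q_def atLeast0LessThan)
  qed
  have q_cong: "[q a = q b] (mod int p ^ n)"
    if "[a = b] (mod int p ^ (n + v))" for a b :: int and n
  proof -
    have "[int (fact r) * q a = int (fact r) * q b] (mod int p ^ (n + v))"
      unfolding fact_q by (intro cong_prod cong_diff that cong_refl)
    then have "int p ^ (n + v) dvd int (fact r) * (q a - q b)"
      by (simp only: cong_iff_dvd_diff right_diff_distrib)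
    then show ?thesis
      unfolding v_def cong_iff_dvd_diff
      by (rule prime_power_mult_dvd_cancel[OF assms(1) fact_gt_zero])
  qed
  define b where "b = (\<lambda>n. q (x (n + v)) mod int p ^ n)"
  have b: "b \<in> carrier (padic_int p)"
    unfolding b_def
    by (rule padic_int_memI[OF p])
      (use padic_int_memD(1)[OF assms(2)] in \<open>auto intro: q_cong\<close>)
  have eq: "[(fact r :: nat)] \<cdot>\<^bsub>padic_int p\<^esub> b = (\<lambda>n. (\<Prod>i<r. x n - int i) mod int p ^ n)"
  proof -
    have "[int (fact r) * q (x (n + v)) = (\<Prod>i<r. x n - int i)] (mod int p ^ n)" for n
      unfolding fact_q
      by (intro cong_prod cong_diff padic_int_cong_le[OF assms(2)] cong_refl) simp
    then show ?thesis
      unfolding padic_int_add_pow[OF p b] by (simp add: b_def cong_def mod_mult_right_eq)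
  qed
  have "c = b" if c: "c \<in> carrier (padic_int p)"
    and ceq: "[(fact r :: nat)] \<cdot>\<^bsub>padic_int p\<^esub> c = [(fact r :: nat)] \<cdot>\<^bsub>padic_int p\<^esub> b" for c
  proof
    fix n
    from ceq have "[int (fact r) * c (n + v) = int (fact r) * b (n + v)] (mod int p ^ (n + v))"
      unfolding padic_int_add_pow[OF p b] padic_int_add_pow[OF p c] cong_def by (rule fun_cong)
    then have "int p ^ (n + v) dvd int (fact r) * (c (n + v) - b (n + v))"
      by (simp only: cong_iff_dvd_diff right_diff_distrib)
    then have "[c (n + v) = b (n + v)] (mod int p ^ n)"
      unfolding v_def cong_iff_dvd_diff
      by (rule prime_power_mult_dvd_cancel[OF assms(1) fact_gt_zero])
    moreover have "[c (n + v) = c n] (mod int p ^ n)" "[b (n + v) = b n] (mod int p ^ n)"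
      by (rule padic_int_cong_le[OF c], simp, rule padic_int_cong_le[OF b], simp)
    ultimately have "[c n = b n] (mod int p ^ n)"
      by (meson cong_sym cong_trans)
    then show "c n = b n"
      using padic_int_memD(2)[OF c] padic_int_memD(2)[OF b] by (simp add: cong_def)
  qed
  then show ?thesis
    unfolding padic_int_falling[OF p assms(2)] eq[symmetric]
    by (intro ex1I[of _ b] conjI b refl) (elim conjE)
qed

end

theory Submission
  imports Defs "HOL-Computational_Algebra.Polynomial"
begin

text \<open>
  Only residues modulo \<open>p\<^sup>2\<close> matter. For \<open>r < p\<close> the factorial of \<open>r\<close> is a unit modulo \<open>p\<^sup>2\<close>, so
  \<open>x\<close> may be replaced by a natural number \<open>N\<close> with the same residue modulo \<open>p\<^sup>2\<close>, and everything
  becomes a congruence between ordinary binomial coefficients.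

  Let \<open>n < p\<close> be the residue of \<open>N\<close> modulo \<open>p\<close>. Then \<open>N choose r\<close> is congruent to \<open>n choose r\<close>
  modulo \<open>p\<close>. Hence for \<open>n < r < p\<close> it is divisible by \<open>p\<close>, and its square vanishes modulo \<open>p\<^sup>2\<close>.
  For \<open>r \<le> n\<close> the symmetry of \<open>n choose r\<close> makes \<open>N choose r\<close> and \<open>N choose (n - r)\<close> congruent modulo
  \<open>p\<close>, so the square of their difference vanishes modulo \<open>p\<^sup>2\<close>. Summing these squares with weights
  \<open>w\<close> that are invariant under \<open>r \<mapsto> n - r\<close> and halving shows that the weighted sum of
  squares is congruent modulo \<open>p\<^sup>2\<close> to the sum of
  \<open>w r * (N choose r) * (N choose (n - r))\<close>
  (\<open>sum_binomial_squares_cong_convolution\<close>).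

  This convolution has an exact value. For \<open>w = 1\<close> it is \<open>(2 * N) choose n\<close>, by Vandermonde, which
  is the second claim. For \<open>w r = (- 1) ^ r\<close>, symmetric because \<open>n = 2 * k\<close> is even, it is the
  coefficient of \<open>z ^ (2 * k)\<close> in \<open>(1 - z) ^ N * (1 + z) ^ N = (1 - z\<^sup>2) ^ N\<close>, which is the first
  claim (\<open>alternating_vandermonde\<close>).
\<close>

section \<open>Sums of squares of binomial coefficients modulo the square of a prime\<close>

lemma fact_mult_binomial_eq_prod:
  "int (fact r) * int (N choose r) = (\<Prod>i<r. int N - int i)"
proof -
  have "real_of_int (int (fact r) * int (N choose r)) = fact r * (real N gchoose r)"
    by (simp add: binomial_gbinomial)
  also have "\<dots> = real_of_int (\<Prod>i<r. int N - int i)"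
    by (simp add: gbinomial_mult_fact atLeast0LessThan)
  finally show ?thesis
    by (simp only: of_int_eq_iff)
qed

text \<open>
  A prime does not divide the factorial of a smaller number, so the defining equation of a binomial
  coefficient determines it modulo every power of \<open>p\<close>.
\<close>

lemma cong_binomial_prime_powerI:
  fixes p :: nat and b :: int
  assumes "prime p" "r < p" "[int (fact r) * b = (\<Prod>i<r. int N - int i)] (mod int p ^ n)"
  shows "[b = int (N choose r)] (mod int p ^ n)"
proof -
  have "coprime (int (fact r)) (int p ^ n)"
    using assms(1,2)
    by (metis coprime_commute coprime_int_iff coprime_power_left_iff not_le prime_dvd_fact_iff
        prime_imp_coprime of_nat_power)
  with assms(3) show ?thesis
    unfolding fact_mult_binomial_eq_prod[symmetric] by (simp only: cong_mult_lcancel)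
qed

lemma cong_binomial_prime_power:
  assumes "prime p" "r < p" "[int N = int M] (mod int p ^ n)"
  shows "[int (N choose r) = int (M choose r)] (mod int p ^ n)"
proof (rule cong_binomial_prime_powerI[OF assms(1,2)])
  show "[int (fact r) * int (N choose r) = (\<Prod>i<r. int M - int i)] (mod int p ^ n)"
    unfolding fact_mult_binomial_eq_prod by (intro cong_prod cong_diff assms(3) cong_refl)
qed

text \<open>
  Expand the weighted sum of \<open>(c (k - r) - c r)\<^sup>2\<close>, each of which is divisible by \<open>m\<^sup>2\<close>: reflection
  identifies the two sums of squares, so the result is twice the difference of the two sides, and
  the factor 2 can be cancelled because \<open>m\<close> is odd.
\<close>

lemma sum_squares_cong_convolution:
  fixes w c :: "nat \<Rightarrow> int" and m :: int
  assumes "odd m"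
    and w: "\<And>r. r \<le> k \<Longrightarrow> w (k - r) = w r"
    and c: "\<And>r. r \<le> k \<Longrightarrow> [c (k - r) = c r] (mod m)"
  shows "[(\<Sum>r\<le>k. w r * c r ^ 2) = (\<Sum>r\<le>k. w r * (c r * c (k - r)))] (mod m ^ 2)"
proof -
  have reflect: "(\<Sum>r\<le>k. w r * c (k - r) ^ 2) = (\<Sum>r\<le>k. w r * c r ^ 2)"
    by (rule sum.reindex_bij_witness[of _ "\<lambda>r. k - r" "\<lambda>r. k - r"]) (auto simp: w)
  have "m ^ 2 dvd (\<Sum>r\<le>k. w r * (c (k - r) - c r) ^ 2)"
    by (intro dvd_sum dvd_mult dvd_power_same)
      (use c in \<open>auto simp: cong_iff_dvd_diff\<close>)
  also have "(\<Sum>r\<le>k. w r * (c (k - r) - c r) ^ 2)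
      = (\<Sum>r\<le>k. w r * c (k - r) ^ 2) + (\<Sum>r\<le>k. w r * c r ^ 2)
        - 2 * (\<Sum>r\<le>k. w r * (c r * c (k - r)))"
    by (simp add: sum_distrib_left power2_eq_square algebra_simps flip: sum.distrib sum_subtractf)
  also have "\<dots> = 2 * ((\<Sum>r\<le>k. w r * c r ^ 2) - (\<Sum>r\<le>k. w r * (c r * c (k - r))))"
    unfolding reflect by simp
  finally have "m ^ 2 dvd 2 * ((\<Sum>r\<le>k. w r * c r ^ 2) - (\<Sum>r\<le>k. w r * (c r * c (k - r))))" .
  moreover have "coprime (m ^ 2) 2"
    using assms(1) by simp
  ultimately show ?thesis
    unfolding cong_iff_dvd_diff by (simp only: coprime_dvd_mult_right_iff)
qed

text \<open>
  The previous lemma applies with \<open>c r = N choose r\<close>, since modulo \<open>p\<close> these numbers form the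
  symmetric row \<open>k choose r\<close> of Pascal's triangle. The terms with \<open>k < r < p\<close>, where that row is
  zero, do not contribute.
\<close>

lemma sum_binomial_squares_cong_convolution:
  fixes p N k :: nat and w :: "nat \<Rightarrow> int"
  assumes "prime p" "odd p" "k < p" "[N = k] (mod p)"
    and w: "\<And>r. r \<le> k \<Longrightarrow> w (k - r) = w r"
  shows "[(\<Sum>r<p. w r * int (N choose r) ^ 2)
      = (\<Sum>r\<le>k. w r * (int (N choose r) * int (N choose (k - r))))] (mod int p ^ 2)"
proof -
  have red: "[int (N choose r) = int (k choose r)] (mod int p)" if "r < p" for r
    using cong_binomial_prime_power[of p r N k 1] that assms(1,4) by (simp add: cong_int_iff)
  have "[(\<Sum>r<p. w r * int (N choose r) ^ 2)
      = (\<Sum>r<p. if r \<le> k then w r * int (N choose r) ^ 2 else 0)] (mod int p ^ 2)"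
  proof (rule cong_sum)
    fix r assume r: "r \<in> {..<p}"
    have "int p ^ 2 dvd w r * int (N choose r) ^ 2" if "\<not> r \<le> k"
      using red[of r] r that by (intro dvd_mult dvd_power_same) (simp add: binomial_eq_0 cong_0_iff)
    then show "[w r * int (N choose r) ^ 2
        = (if r \<le> k then w r * int (N choose r) ^ 2 else 0)] (mod int p ^ 2)"
      by (simp add: cong_0_iff)
  qed
  also have "(\<Sum>r<p. if r \<le> k then w r * int (N choose r) ^ 2 else 0)
      = (\<Sum>r\<le>k. w r * int (N choose r) ^ 2)"
    by (rule sum.mono_neutral_cong_right) (use assms(3) in auto)
  also have "[\<dots> = (\<Sum>r\<le>k. w r * (int (N choose r) * int (N choose (k - r))))] (mod int p ^ 2)"
  proof (rule sum_squares_cong_convolution)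
    show "odd (int p)" using assms(2) by simp
    show "w (k - r) = w r" if "r \<le> k" for r using that by (rule w)
    show "[int (N choose (k - r)) = int (N choose r)] (mod int p)" if "r \<le> k" for r
      using red[of r] red[of "k - r"] that assms(3) binomial_symmetric[of r k]
      by (metis cong_sym cong_trans diff_le_self le_less_trans)
  qed
  finally show ?thesis .
qed

text \<open>
  Both sides are the coefficient of \<open>z ^ (2 * k)\<close> in \<open>(1 - z) ^ N * (1 + z) ^ N = (1 - z\<^sup>2) ^ N\<close>.
\<close>

lemma alternating_vandermonde:
  "(\<Sum>r\<le>2 * k. (- 1) ^ r * (int (N choose r) * int (N choose (2 * k - r)))) = (- 1) ^ k * int (N choose k)"
proof -
  have "[:1, - 1:] ^ N * [:1, 1:] ^ N = ([:1, 0, - 1:] :: int poly) ^ N"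
    by (simp flip: power_mult_distrib)
  also have "\<dots> = (1 + monom (- 1) 2) ^ N"
    by (simp add: monom_altdef numeral_2_eq_2 one_pCons)
  also have "\<dots> = (\<Sum>i\<le>N. monom (int (N choose i) * (- 1) ^ i) (2 * i))"
    by (subst add.commute, subst binomial_ring)
      (simp add: monom_power mult_monom of_nat_monom mult.commute)
  finally have eq: "[:1, - 1:] ^ N * [:1, 1:] ^ N
      = (\<Sum>i\<le>N. monom (int (N choose i) * (- 1) ^ i) (2 * i))" .
  have "(\<Sum>r\<le>2 * k. (- 1) ^ r * (int (N choose r) * int (N choose (2 * k - r))))
      = coeff ([:1, - 1:] ^ N * [:1, 1:] ^ N) (2 * k)"
    unfolding coeff_mult
  proof (rule sum.cong[OF refl])
    fix r
    have "coeff ([:1, - 1:] ^ N) r = (- 1) ^ r * int (N choose r)"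
      by (cases "r \<le> N") (simp_all add: coeff_linear_poly_power binomial_eq_0 coeff_eq_0 degree_power_eq)
    moreover have "coeff ([:1, 1:] ^ N) (2 * k - r) = int (N choose (2 * k - r))"
      by (cases "2 * k - r \<le> N") (simp_all add: coeff_linear_poly_power binomial_eq_0 coeff_eq_0 degree_power_eq)
    ultimately show "(- 1) ^ r * (int (N choose r) * int (N choose (2 * k - r)))
        = coeff ([:1, - 1:] ^ N) r * coeff ([:1, 1:] ^ N) (2 * k - r)"
      by simp
  qed
  also have "\<dots> = (\<Sum>i\<le>N. if i = k then int (N choose i) * (- 1) ^ i else 0)"
    unfolding eq coeff_sum by (intro sum.cong) auto
  also have "\<dots> = (- 1) ^ k * int (N choose k)"
    by (simp add: sum.delta)
  finally show ?thesis .
qed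

section \<open>Congruences of p-adic integers\<close>

lemma padic_int_neg_one:
  assumes "p > 0"
  shows "\<ominus>\<^bsub>padic_int p\<^esub> \<one>\<^bsub>padic_int p\<^esub> = (\<lambda>n. (- 1) mod int p ^ n)"
proof -
  interpret cring "padic_int p" by (rule cring_padic_int[OF assms])
  have "\<ominus>\<^bsub>padic_int p\<^esub> \<one>\<^bsub>padic_int p\<^esub> = \<zero>\<^bsub>padic_int p\<^esub> \<ominus>\<^bsub>padic_int p\<^esub> \<one>\<^bsub>padic_int p\<^esub>"
    by (simp add: a_minus_def)
  also have "\<dots> = (\<lambda>n. (- 1) mod int p ^ n)"
    unfolding padic_int_diff[OF assms zero_closed one_closed]
    by (simp add: padic_int_zero padic_int_one mod_simps)
  finally show ?thesis .
qed

lemma padic_int_pow: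
  assumes "p > 0"
  shows "[(a [^]\<^bsub>padic_int p\<^esub> (j::nat)) n = a n ^ j] (mod int p ^ n)"
proof -
  interpret cring "padic_int p" by (rule cring_padic_int[OF assms])
  show ?thesis
    by (induction j) (simp_all add: padic_int_one padic_int_mult cong_def mod_simps
        mult.commute, metis mod_mult_right_eq)
qed

lemma padic_int_finsum:
  assumes "p > 0" "finite A" "f \<in> A \<rightarrow> carrier (padic_int p)"
  shows "[(\<Oplus>\<^bsub>padic_int p\<^esub>r\<in>A. f r) n = (\<Sum>r\<in>A. f r n)] (mod int p ^ n)"
proof -
  interpret cring "padic_int p" by (rule cring_padic_int[OF assms(1)])
  show ?thesis
    using assms(2,3)
    by (induction A rule: finite_induct)
      (simp_all add: padic_int_zero padic_int_add cong_def Pi_def, metis mod_add_right_eq)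
qed

text \<open>
  If the components at \<open>m\<close> agree, all components of \<open>a - b\<close> from \<open>m\<close> on are divisible by
  \<open>p ^ m\<close>. Dividing costs \<open>m\<close> digits of precision, so the quotient modulo \<open>p ^ n\<close> is read off
  from the component at \<open>n + m\<close>.
\<close>

lemma ring_cong_padic_int_iff:
  assumes "prime p" "a \<in> carrier (padic_int p)" "b \<in> carrier (padic_int p)"
  shows "ring_cong (padic_int p) (p ^ m) a b \<longleftrightarrow> [a m = b m] (mod int p ^ m)"
proof -
  have p: "p > 0" using assms(1) by (simp add: prime_gt_0_nat)
  have div_iff: "ring_cong (padic_int p) (p ^ m) a b \<longleftrightarrow>
      (\<exists>c\<in>carrier (padic_int p). (\<lambda>n. (a n - b n) mod int p ^ n)
         = (\<lambda>n. (int p ^ m * c n) mod int p ^ n))"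
    by (simp add: ring_cong_def factor_def padic_int_diff[OF p assms(2,3)]
        padic_int_of_nat[OF p] padic_int_mult mod_simps)
  show ?thesis
  proof
    assume "ring_cong (padic_int p) (p ^ m) a b"
    then obtain c where "(\<lambda>n. (a n - b n) mod int p ^ n) = (\<lambda>n. (int p ^ m * c n) mod int p ^ n)"
      unfolding div_iff by blast
    from fun_cong[OF this, of m] show "[a m = b m] (mod int p ^ m)"
      by (simp add: cong_iff_dvd_diff mod_0_imp_dvd)
  next
    assume ab: "[a m = b m] (mod int p ^ m)"
    define f where "f = (\<lambda>n. (a (n + m) - b (n + m)) div int p ^ m)"
    have f: "int p ^ m * f n = a (n + m) - b (n + m)" for n
    proof -
      have "[a (n + m) = b (n + m)] (mod int p ^ m)"
        using padic_int_cong_le[OF assms(2), of m "n + m"]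
          padic_int_cong_le[OF assms(3), of m "n + m"] ab
        by (meson cong_sym cong_trans le_add2)
      then show ?thesis
        by (simp add: f_def cong_iff_dvd_diff)
    qed
    have "[f (Suc n) = f n] (mod int p ^ n)" for n
    proof -
      have "[int p ^ m * f (Suc n) = int p ^ m * f n] (mod int p ^ (n + m))"
        unfolding f using padic_int_memD(1)[OF assms(2)] padic_int_memD(1)[OF assms(3)]
        by (auto intro: cong_diff)
      then have "int p ^ m * int p ^ n dvd int p ^ m * (f (Suc n) - f n)"
        by (simp add: cong_iff_dvd_diff power_add right_diff_distrib mult.commute)
      then show ?thesis
        using p by (simp add: cong_iff_dvd_diff)
    qed
    then have "(\<lambda>n. f n mod int p ^ n) \<in> carrier (padic_int p)"
      by (rule padic_int_memI[OF p])
    moreover have "(a n - b n) mod int p ^ n = (int p ^ m * (f n mod int p ^ n)) mod int p ^ n" for n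
      using cong_diff[OF padic_int_cong_le[OF assms(2), of n "n + m"]
          padic_int_cong_le[OF assms(3), of n "n + m"]]
      by (simp add: mod_simps f cong_def)
    ultimately show "ring_cong (padic_int p) (p ^ m) a b"
      unfolding div_iff by (intro bexI[of _ "\<lambda>n. f n mod int p ^ n"] ext)
  qed
qed

lemma padic_int_binom:
  assumes "prime p" "x \<in> carrier (padic_int p)"
  shows padic_int_binom_closed: "ring_binom (padic_int p) x r \<in> carrier (padic_int p)"
    and padic_int_binom_cong: "r < p \<Longrightarrow> [int N = x n] (mod int p ^ n) \<Longrightarrow>
      [ring_binom (padic_int p) x r n = int (N choose r)] (mod int p ^ n)"
proof -
  have p: "p > 0" using assms(1) by (simp add: prime_gt_0_nat)
  define b where "b = ring_binom (padic_int p) x r"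
  have b: "b \<in> carrier (padic_int p)"
     "[(fact r :: nat)] \<cdot>\<^bsub>padic_int p\<^esub> b =
             (\<Otimes>\<^bsub>padic_int p\<^esub>i\<in>{..<r}. x \<ominus>\<^bsub>padic_int p\<^esub> ([i] \<cdot>\<^bsub>padic_int p\<^esub> \<one>\<^bsub>padic_int p\<^esub>))"
    using theI'[OF padic_int_binom_ex1[OF assms, of r]] by (simp_all add: b_def ring_binom_def)
  then show "ring_binom (padic_int p) x r \<in> carrier (padic_int p)"
    by (simp add: b_def)
  assume r: "r < p" and N: "[int N = x n] (mod int p ^ n)"
  have "[int (fact r) * b n = (\<Prod>i<r. x n - int i)] (mod int p ^ n)"
    using fun_cong[OF b(2), of n]
    unfolding padic_int_add_pow[OF p b(1)] padic_int_falling[OF p assms(2)] by (simp add: cong_def)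
  also have "[(\<Prod>i<r. x n - int i) = (\<Prod>i<r. int N - int i)] (mod int p ^ n)"
    by (intro cong_prod cong_diff cong_sym[OF N] cong_refl)
  finally show "[ring_binom (padic_int p) x r n = int (N choose r)] (mod int p ^ n)"
    unfolding b_def by (rule cong_binomial_prime_powerI[OF assms(1) r])
qed

theorem theorem1p2:
  fixes p :: nat and Zp :: "(nat \<Rightarrow> int) ring" (structure) and x :: "nat \<Rightarrow> int"
  assumes "prime p" and "odd p"
    and "Zp = padic_int p" and "x \<in> carrier Zp"
  shows
    "(\<forall>k\<in>{0..(p - 1) div 2}.
        ring_cong Zp p x ([(2 * k)] \<cdot> \<one>) \<longrightarrow>
        ring_cong Zp (p ^ 2)
          (\<Oplus>r\<in>{0..p - 1}. (\<ominus> \<one>) [^] r \<otimes> ring_binom Zp x r [^] (2::nat))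
          ((\<ominus> \<one>) [^] k \<otimes> ring_binom Zp x k)) \<and>
     (\<forall>k\<in>{0..p - 1}.
        ring_cong Zp p x ([k] \<cdot> \<one>) \<longrightarrow>
        ring_cong Zp (p ^ 2)
          (\<Oplus>r\<in>{0..p - 1}. ring_binom Zp x r [^] (2::nat))
          (ring_binom Zp ([(2::nat)] \<cdot> x) k))"
proof (intro conjI ballI impI)
  have p: "p > 0" using assms(1) by (simp add: prime_gt_0_nat)
  interpret cring Zp unfolding assms(3) by (rule cring_padic_int[OF p])
  \<comment> \<open>The components at 2 carry the residues modulo \<open>p\<^sup>2\<close>; they are nonnegative representatives.\<close>
  define N where "N = nat (x 2)"
  have N: "int N = x 2"
    using assms(4) by (simp add: N_def assms(3) padic_int_def)
  have residue: "[N = j] (mod p)" if "ring_cong Zp p x ([j] \<cdot> \<one>)" for j :: nat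
  proof -
    have "[x 1 = int j] (mod int p)"
      using that ring_cong_padic_int_iff[of p x "[j] \<cdot> \<one>" 1] assms(1,4)
      unfolding assms(3) padic_int_of_nat[OF p]
      using add.nat_pow_closed[OF one_closed, of j]
      by (simp add: assms(3) padic_int_of_nat[OF p] cong_def)
    moreover have "[x 2 = x 1] (mod int p)"
      using padic_int_cong_le[of x p 1 2] assms(3,4) by simp
    ultimately have "[int N = int j] (mod int p)"
      unfolding N by (rule cong_trans[rotated])
    then show ?thesis by (simp add: cong_int_iff)
  qed
  have binom: "ring_binom Zp x r \<in> carrier Zp" for r
    using padic_int_binom_closed assms by simp
  have binom2: "[ring_binom Zp x r 2 = int (N choose r)] (mod int p ^ 2)" if "r < p" for r
    using padic_int_binom_cong[of p x r N 2] that assms N by simp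
  have square: "[(ring_binom Zp x r [^] (2::nat)) 2 = int (N choose r) ^ 2] (mod int p ^ 2)"
    if "r < p" for r
    unfolding assms(3)
    by (rule cong_trans[OF padic_int_pow[OF p]]) (rule cong_pow[OF binom2[OF that, unfolded assms(3)]])
  have sign: "[((\<ominus> \<one>) [^] r \<otimes> b) 2 = (- 1) ^ r * c] (mod int p ^ 2)"
    if "[b 2 = c] (mod int p ^ 2)" for r :: nat and b c
  proof -
    have "[((\<ominus> \<one>) [^] r) 2 = ((\<ominus> \<one>) 2) ^ r] (mod int p ^ 2)"
      unfolding assms(3) by (rule padic_int_pow[OF p])
    also have "[((\<ominus> \<one>) 2) ^ r = (- 1) ^ r] (mod int p ^ 2)"
      unfolding assms(3) padic_int_neg_one[OF p] by (intro cong_pow) (simp add: cong_def)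
    finally have "[((\<ominus> \<one>) [^] r) 2 * b 2 = (- 1) ^ r * c] (mod int p ^ 2)"
      using that by (rule cong_mult)
    then show ?thesis
      by (simp add: assms(3) padic_int_mult cong_def)
  qed
  have sum: "[(\<Oplus>r\<in>{0..p - 1}. f r) 2 = (\<Sum>r<p. c r)] (mod int p ^ 2)"
    if "\<And>r. f r \<in> carrier Zp" and "\<And>r. r < p \<Longrightarrow> [f r 2 = c r] (mod int p ^ 2)" for f c
  proof -
    have "{0..p - 1} = {..<p}" using p by auto
    then have "[(\<Oplus>r\<in>{0..p - 1}. f r) 2 = (\<Sum>r<p. f r 2)] (mod int p ^ 2)"
      using padic_int_finsum[OF p, of "{..<p}" f 2] that(1) assms(3) by simp
    also have "[(\<Sum>r<p. f r 2) = (\<Sum>r<p. c r)] (mod int p ^ 2)"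
      using that(2) by (intro cong_sum) simp
    finally show ?thesis .
  qed
  {
    fix k assume k: "k \<in> {0..(p - 1) div 2}" and xk: "ring_cong Zp p x ([(2 * k)] \<cdot> \<one>)"
    have k2: "2 * k < p" using k p by auto
    have "[(\<Oplus>r\<in>{0..p - 1}. (\<ominus> \<one>) [^] r \<otimes> ring_binom Zp x r [^] (2::nat)) 2
        = (\<Sum>r<p. (- 1) ^ r * int (N choose r) ^ 2)] (mod int p ^ 2)"
      by (rule sum) (use binom sign square in auto)
    also have "[(\<Sum>r<p. (- 1) ^ r * int (N choose r) ^ 2)
        = (\<Sum>r\<le>2 * k. (- 1) ^ r * (int (N choose r) * int (N choose (2 * k - r))))] (mod int p ^ 2)"
      by (rule sum_binomial_squares_cong_convolution[OF assms(1,2) k2 residue[OF xk]])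
        (simp add: minus_one_power_iff)
    also have "(\<Sum>r\<le>2 * k. (- 1) ^ r * (int (N choose r) * int (N choose (2 * k - r))))
        = (- 1) ^ k * int (N choose k)"
      by (rule alternating_vandermonde)
    also have "[(- 1) ^ k * int (N choose k) = ((\<ominus> \<one>) [^] k \<otimes> ring_binom Zp x k) 2] (mod int p ^ 2)"
      using k2 by (intro cong_sym[OF sign] binom2) simp
    finally show "ring_cong Zp (p ^ 2)
          (\<Oplus>r\<in>{0..p - 1}. (\<ominus> \<one>) [^] r \<otimes> ring_binom Zp x r [^] (2::nat))
          ((\<ominus> \<one>) [^] k \<otimes> ring_binom Zp x k)"
      using binom by (subst assms(3), subst ring_cong_padic_int_iff[OF assms(1)])
        (auto simp flip: assms(3) intro!: finsum_closed)
  next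
    fix k assume k: "k \<in> {0..p - 1}" and xk: "ring_cong Zp p x ([k] \<cdot> \<one>)"
    have kp: "k < p" using k p by auto
    have x2: "[(2::nat)] \<cdot> x \<in> carrier Zp"
      using assms(4) by (rule add.nat_pow_closed)
    have "[(\<Oplus>r\<in>{0..p - 1}. ring_binom Zp x r [^] (2::nat)) 2
        = (\<Sum>r<p. 1 * int (N choose r) ^ 2)] (mod int p ^ 2)"
      by (rule sum) (use binom square in auto)
    also have "[(\<Sum>r<p. 1 * int (N choose r) ^ 2)
        = (\<Sum>r\<le>k. 1 * (int (N choose r) * int (N choose (k - r))))] (mod int p ^ 2)"
      by (rule sum_binomial_squares_cong_convolution[OF assms(1,2) kp residue[OF xk]]) simp
    also have "(\<Sum>r\<le>k. 1 * (int (N choose r) * int (N choose (k - r)))) = int ((2 * N) choose k)"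
      using vandermonde[of N N k] by (simp add: mult_2 flip: of_nat_mult of_nat_sum)
    also have "[int ((2 * N) choose k) = ring_binom Zp ([(2::nat)] \<cdot> x) k 2] (mod int p ^ 2)"
    proof (rule cong_sym)
      have "[int (2 * N) = ([(2::nat)] \<cdot> x) 2] (mod int p ^ 2)"
        using padic_int_add_pow[OF p, of x 2] assms(3,4) N by (simp add: cong_def)
      then show "[ring_binom Zp ([(2::nat)] \<cdot> x) k 2 = int ((2 * N) choose k)] (mod int p ^ 2)"
        using padic_int_binom_cong[OF assms(1) _ kp] x2 assms(3) by blast
    qed
    finally show "ring_cong Zp (p ^ 2)
          (\<Oplus>r\<in>{0..p - 1}. ring_binom Zp x r [^] (2::nat))
          (ring_binom Zp ([(2::nat)] \<cdot> x) k)"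
      using binom padic_int_binom_closed[OF assms(1) x2[unfolded assms(3)]]
      by (subst assms(3), subst ring_cong_padic_int_iff[OF assms(1)])
        (auto simp flip: assms(3) intro!: finsum_closed)
  }
qed

end
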